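(* If $X$ is a $T_0$ space and $Y$ is a well-filtered space, then the function space $\mathbf{Top}_0(X,Y)$ of all continuous functions $X\to Y$, equipped with the topology of pointwise convergence (the relative product topology from $Y^X$), is well-filtered.
   Context: A subset of a space is saturated if it is an intersection of open sets. $\mathsf{K}(Y)$ is the set of all nonempty compact saturated subsets of $Y$. A family $\mathcal K\subseteq\mathsf{K}(Y)$ is filtered if it is nonempty and any two members of it contain a common member of it. A space $Y$ is well-filtered if it is $T_0$ and for every filtered family $\mathcal K\subseteq\mathsf{K}(Y)$ and every open set $U$, $\bigcap\mathcal K\subseteq U$ implies $K\subseteq U$ for some $K\in\mathcal K$. *)

theory Defs
  imports "HOL-Analysis.Analysis"
begin

text \<open>The intersection is taken inside \<^term>\<open>topspace Y\<close>, so that the empty intersection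
  is the whole space.\<close>

definition saturatedin :: "'a topology \<Rightarrow> 'a set \<Rightarrow> bool" where
  "saturatedin Y S \<longleftrightarrow> (\<exists>\<U>. (\<forall>U\<in>\<U>. openin Y U) \<and> S = topspace Y \<inter> \<Inter>\<U>)"

definition compact_saturated_sets :: "'a topology \<Rightarrow> 'a set set" where
  "compact_saturated_sets Y = {K. K \<noteq> {} \<and> compactin Y K \<and> saturatedin Y K}"

definition filtered_family :: "'a set set \<Rightarrow> bool" where
  "filtered_family \<K> \<longleftrightarrow>
    \<K> \<noteq> {} \<and> (\<forall>K1\<in>\<K>. \<forall>K2\<in>\<K>. \<exists>K3\<in>\<K>. K3 \<subseteq> K1 \<and> K3 \<subseteq> K2)"

definition well_filtered_space :: "'a topology \<Rightarrow> bool" where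
  "well_filtered_space Y \<longleftrightarrow>
    t0_space Y \<and>
    (\<forall>\<K> U. \<K> \<subseteq> compact_saturated_sets Y \<longrightarrow> filtered_family \<K> \<longrightarrow> openin Y U \<longrightarrow>
      \<Inter>\<K> \<subseteq> U \<longrightarrow> (\<exists>K\<in>\<K>. K \<subseteq> U))"

text \<open>A function on \<^term>\<open>topspace X\<close> is represented by its unique extension that is
  \<^term>\<open>undefined\<close> outside \<^term>\<open>topspace X\<close>: \<^const>\<open>subtopology\<close> intersects the given set with
  \<^term>\<open>topspace (product_topology (\<lambda>_. Y) (topspace X))\<close>, whose elements are extensional.\<close>

definition pointwise_function_space :: "'a topology \<Rightarrow> 'b topology \<Rightarrow> ('a \<Rightarrow> 'b) topology" where
  "pointwise_function_space X Y =
    subtopology (product_topology (\<lambda>_. Y) (topspace X)) {f. continuous_map X Y f}"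

end

theory Submission
  imports Defs
begin

text \<open>
  The proof is a version of the topological Rudin lemma, phrased with open sets.  Suppose that
  \<open>U\<close> is open and contains no member of a filtered family \<open>\<K>\<close> of compact saturated sets.  By
  compactness and Zorn's lemma, \<open>U\<close> lies in an open set \<open>W\<close> that is maximal among the open sets
  containing no member of \<open>\<K>\<close> (\<open>ex_maximal_avoiding\<close>).  Such a \<open>W\<close> is prime, since \<open>\<K>\<close> is
  filtered; equivalently, its complement is an irreducible closed set.  Well-filteredness follows
  as soon as this complement is the closure of a point \<open>g\<close>
  (\<open>well_filtered_spaceI_generic_point\<close>): then \<open>g\<close> lies outside \<open>W\<close>, hence outside \<open>U\<close>, but it
  lies in every open set around a member of \<open>\<K>\<close>, hence in \<open>\<Inter>\<K>\<close>.

  In the function space, \<open>g\<close> is built coordinatewise.  For each point \<open>x\<close>, the image of the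
  complement of \<open>W\<close> under evaluation at \<open>x\<close> has the same closure as a single point \<open>g x\<close>,
  because \<open>Y\<close> is well-filtered (\<open>ex_generic_point_of_image\<close>).  Continuity of \<open>g\<close> comes for free:
  \<open>g x \<in> V\<close> holds precisely if \<open>f x \<in> V\<close> for some function \<open>f\<close> outside \<open>W\<close>, so the preimage of an
  open set under \<open>g\<close> is a union of preimages under continuous functions.  Finally \<open>g\<close> is generic for
  the complement of \<open>W\<close> because basic open sets are finite intersections of preimages under
  evaluations, and \<open>W\<close> is prime.
\<close>

section \<open>Saturations of compact sets\<close>

definition saturation_of :: "'a topology \<Rightarrow> 'a set \<Rightarrow> 'a set" where
  "saturation_of Y S = topspace Y \<inter> \<Inter>{V. openin Y V \<and> S \<subseteq> V}"

lemma saturation_of_superset: "S \<subseteq> topspace Y \<Longrightarrow> S \<subseteq> saturation_of Y S"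
  by (auto simp: saturation_of_def)

lemma saturation_of_minimal: "openin Y V \<Longrightarrow> S \<subseteq> V \<Longrightarrow> saturation_of Y S \<subseteq> V"
  by (auto simp: saturation_of_def)

lemma saturation_of_mono: "S \<subseteq> T \<Longrightarrow> saturation_of Y S \<subseteq> saturation_of Y T"
  by (auto simp: saturation_of_def)

text \<open>A set and its saturation have the same open covers.\<close>

lemma compactin_saturation_of:
  assumes "compactin Y S"
  shows "compactin Y (saturation_of Y S)"
  unfolding compactin_def
proof (intro conjI allI impI)
  show "saturation_of Y S \<subseteq> topspace Y"
    by (auto simp: saturation_of_def)
  fix \<U> assume \<U>: "Ball \<U> (openin Y) \<and> saturation_of Y S \<subseteq> \<Union>\<U>"
  then have "S \<subseteq> \<Union>\<U>"
    using saturation_of_superset[OF compactin_subset_topspace[OF assms]] by blast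
  then obtain \<F> where \<F>: "finite \<F>" "\<F> \<subseteq> \<U>" "S \<subseteq> \<Union>\<F>"
    using assms \<U> unfolding compactin_def by meson
  then have "saturation_of Y S \<subseteq> \<Union>\<F>"
    using \<U> by (intro saturation_of_minimal openin_Union) auto
  then show "\<exists>\<F>. finite \<F> \<and> \<F> \<subseteq> \<U> \<and> saturation_of Y S \<subseteq> \<Union>\<F>"
    using \<F> by blast
qed

lemma saturation_of_in_compact_saturated_sets:
  assumes "compactin Y S" "S \<noteq> {}"
  shows "saturation_of Y S \<in> compact_saturated_sets Y"
proof -
  have "saturation_of Y S \<noteq> {}"
    using saturation_of_superset[OF compactin_subset_topspace[OF assms(1)]] assms(2) by blast
  moreover have "saturatedin Y (saturation_of Y S)"
    unfolding saturatedin_def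
    by (rule exI[of _ "{V. openin Y V \<and> S \<subseteq> V}"]) (simp add: saturation_of_def)
  ultimately show ?thesis
    using compactin_saturation_of[OF assms(1)] by (simp add: compact_saturated_sets_def)
qed

lemma in_compact_saturated_setI:
  assumes "K \<in> compact_saturated_sets Z" "p \<in> topspace Z"
    and "\<And>V. openin Z V \<Longrightarrow> K \<subseteq> V \<Longrightarrow> p \<in> V"
  shows "p \<in> K"
proof -
  obtain \<U> where \<U>: "\<forall>U\<in>\<U>. openin Z U" "K = topspace Z \<inter> \<Inter>\<U>"
    using assms(1) by (auto simp: compact_saturated_sets_def saturatedin_def)
  then have "p \<in> U" if "U \<in> \<U>" for U
    using assms(3)[of U] that by blast
  then show ?thesis
    using \<U>(2) assms(2) by blast
qed

section \<open>Maximal open sets avoiding a filtered family\<close>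

text \<open>The third condition is maximality of \<open>W\<close> among the open sets containing no member of the
  family, in the form in which it is applied: enlarging \<open>W\<close> by any open set that is not already
  contained in \<open>W\<close> captures a member.\<close>

definition maximal_avoiding :: "'a topology \<Rightarrow> 'a set set \<Rightarrow> 'a set \<Rightarrow> bool" where
  "maximal_avoiding Z \<K> W \<longleftrightarrow>
    openin Z W \<and> (\<forall>K\<in>\<K>. \<not> K \<subseteq> W) \<and>
    (\<forall>V. openin Z V \<longrightarrow> \<not> V \<subseteq> W \<longrightarrow> (\<exists>K\<in>\<K>. K \<subseteq> W \<union> V))"

text \<open>Zorn's lemma applies because a compact set covered by a chain of open sets is contained in one
  member of the chain.\<close>

lemma ex_maximal_avoiding:
  assumes compact: "\<And>K. K \<in> \<K> \<Longrightarrow> compactin Z K"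
    and U: "openin Z U" "\<forall>K\<in>\<K>. \<not> K \<subseteq> U"
  obtains W where "U \<subseteq> W" "maximal_avoiding Z \<K> W"
proof -
  define \<A> where "\<A> = {W. openin Z W \<and> U \<subseteq> W \<and> (\<forall>K\<in>\<K>. \<not> K \<subseteq> W)}"
  have "\<Union>\<C> \<in> \<A>" if \<C>: "\<C> \<noteq> {}" "subset.chain \<A> \<C>" for \<C>
  proof -
    have sub: "\<C> \<subseteq> \<A>"
      using \<C>(2) by (simp add: subset.chain_def)
    have "\<not> K \<subseteq> \<Union>\<C>" if K: "K \<in> \<K>" for K
    proof
      assume "K \<subseteq> \<Union>\<C>"
      moreover have "Ball \<C> (openin Z)"
        using sub by (auto simp: \<A>_def)
      ultimately obtain \<F> where \<F>: "finite \<F>" "\<F> \<subseteq> \<C>" "K \<subseteq> \<Union>\<F>"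
        using compact[OF K] unfolding compactin_def by meson
      have "\<exists>C\<in>\<C>. \<Union>\<F> \<subseteq> C"
      proof (cases "\<F> = {}")
        case False
        have "X \<subseteq> Y \<or> Y \<subseteq> X" if "X \<in> \<F>" "Y \<in> \<F>" for X Y
          using \<C>(2) subsetD[OF \<F>(2) that(1)] subsetD[OF \<F>(2) that(2)]
          by (simp add: subset_chain_def)
        then have "subset.chain \<A> \<F>"
          using subset_trans[OF \<F>(2) sub] by (simp add: subset_chain_def)
        then show ?thesis
          using Union_in_chain[OF \<F>(1) False] \<F>(2) by blast
      next
        case True
        then show ?thesis
          using \<C>(1) by (simp add: ex_in_conv)
      qed
      then obtain C where C: "C \<in> \<C>" "K \<subseteq> C"
        using \<F>(3) by (meson subset_trans)
      from subsetD[OF sub C(1)] show False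
        using C(2) K by (simp add: \<A>_def)
    qed
    moreover have "openin Z (\<Union>\<C>)"
      using sub by (intro openin_Union) (auto simp: \<A>_def)
    moreover have "U \<subseteq> \<Union>\<C>"
      using sub \<C>(1) by (auto simp: \<A>_def)
    ultimately show ?thesis
      by (simp add: \<A>_def)
  qed
  moreover have "\<A> \<noteq> {}"
    using U by (auto simp: \<A>_def)
  ultimately obtain W where W: "W \<in> \<A>" and max: "\<And>V. V \<in> \<A> \<Longrightarrow> W \<subseteq> V \<Longrightarrow> V = W"
    using subset_Zorn_nonempty[of \<A>] by blast
  have "\<exists>K\<in>\<K>. K \<subseteq> W \<union> V" if "openin Z V" "\<not> V \<subseteq> W" for V
    using max[of "W \<union> V"] W that by (auto simp: \<A>_def)
  then have "maximal_avoiding Z \<K> W"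
    using W by (auto simp: maximal_avoiding_def \<A>_def)
  with W show ?thesis
    by (intro that) (auto simp: \<A>_def)
qed

text \<open>Primeness uses that the family is filtered: if \<open>W\<close> enlarged by \<open>V\<^sub>1\<close> and \<open>W\<close> enlarged by
  \<open>V\<^sub>2\<close> each contain a member, then a common smaller member lies in \<open>W \<union> (V\<^sub>1 \<inter> V\<^sub>2)\<close>.\<close>

lemma maximal_avoiding_prime:
  assumes "filtered_family \<K>" "maximal_avoiding Z \<K> W"
    and "openin Z V1" "openin Z V2" "\<not> V1 \<subseteq> W" "\<not> V2 \<subseteq> W"
  shows "\<not> V1 \<inter> V2 \<subseteq> W"
proof
  assume sub: "V1 \<inter> V2 \<subseteq> W"
  obtain K1 K2 where "K1 \<in> \<K>" "K1 \<subseteq> W \<union> V1" "K2 \<in> \<K>" "K2 \<subseteq> W \<union> V2"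
    using assms(2-) unfolding maximal_avoiding_def by meson
  moreover from this obtain K3 where "K3 \<in> \<K>" "K3 \<subseteq> K1" "K3 \<subseteq> K2"
    using assms(1) unfolding filtered_family_def by meson
  ultimately have "K3 \<in> \<K>" "K3 \<subseteq> W"
    using sub by blast+
  then show False
    using assms(2) by (auto simp: maximal_avoiding_def)
qed

lemma maximal_avoiding_prime_finite:
  assumes "filtered_family \<K>" "maximal_avoiding Z \<K> W" "\<Union>\<K> \<subseteq> topspace Z"
    and "finite I" "\<And>i. i \<in> I \<Longrightarrow> openin Z (V i)" "\<And>i. i \<in> I \<Longrightarrow> \<not> V i \<subseteq> W"
  shows "\<not> topspace Z \<inter> (\<Inter>i\<in>I. V i) \<subseteq> W"
  using assms(4-)
proof (induction I rule: finite_induct)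
  case empty
  obtain K where "K \<in> \<K>"
    using assms(1) by (auto simp: filtered_family_def)
  moreover have "K \<subseteq> topspace Z" if "K \<in> \<K>" for K
    using assms(3) that by (simp add: Sup_le_iff)
  moreover have "\<not> K \<subseteq> W" if "K \<in> \<K>" for K
    using assms(2) that by (simp add: maximal_avoiding_def)
  ultimately show ?case
    by (simp add: subset_iff) metis
next
  case (insert i I)
  have "openin Z (topspace Z \<inter> (\<Inter>i\<in>I. V i))"
    using openin_INT[OF insert.hyps(1), of Z V] insert.prems(1) by (simp add: Int_commute)
  then have "\<not> V i \<inter> (topspace Z \<inter> (\<Inter>i\<in>I. V i)) \<subseteq> W"
    by (intro maximal_avoiding_prime[OF assms(1,2)] insert.IH insert.prems insertI1 insertI2)
  then show ?case
    by auto
qed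

section \<open>Generic points and well-filteredness\<close>

text \<open>The point \<open>p\<close> below is a generic point of the complement of \<open>W\<close>: an open set contains \<open>p\<close>
  precisely if it meets the complement, so that this complement is the closure of \<open>p\<close>.\<close>

lemma well_filtered_spaceI_generic_point:
  assumes "t0_space Z"
    and generic: "\<And>\<K> W. \<lbrakk>\<K> \<subseteq> compact_saturated_sets Z; filtered_family \<K>; maximal_avoiding Z \<K> W\<rbrakk>
      \<Longrightarrow> \<exists>p\<in>topspace Z. \<forall>V. openin Z V \<longrightarrow> (p \<in> V \<longleftrightarrow> \<not> V \<subseteq> W)"
  shows "well_filtered_space Z"
  unfolding well_filtered_space_def
proof (intro conjI allI impI)
  fix \<K> U
  assume \<K>: "\<K> \<subseteq> compact_saturated_sets Z" "filtered_family \<K>"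
    and U: "openin Z U" "\<Inter>\<K> \<subseteq> U"
  show "\<exists>K\<in>\<K>. K \<subseteq> U"
  proof (rule ccontr)
    assume "\<not> (\<exists>K\<in>\<K>. K \<subseteq> U)"
    moreover have "compactin Z K" if "K \<in> \<K>" for K
      using \<K>(1) that by (auto simp: compact_saturated_sets_def)
    ultimately obtain W where W: "U \<subseteq> W" "maximal_avoiding Z \<K> W"
      using ex_maximal_avoiding[of \<K> Z U] U(1) by blast
    then obtain p where p: "p \<in> topspace Z" "\<And>V. openin Z V \<Longrightarrow> p \<in> V \<longleftrightarrow> \<not> V \<subseteq> W"
      using generic[OF \<K>] by blast
    have "p \<in> K" if K: "K \<in> \<K>" for K
    proof (rule in_compact_saturated_setI)
      show "p \<in> V" if "openin Z V" "K \<subseteq> V" for V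
        using p(2) that K W(2) unfolding maximal_avoiding_def by (meson subset_trans)
    qed (use K \<K>(1) p(1) in auto)
    then show False
      using U p(2) W(1) by blast
  qed
qed (fact assms(1))

text \<open>The point \<open>y\<close> is found by applying well-filteredness of \<open>Y\<close> to the saturations of the images
  of the sets \<open>K - W\<close>, together with the largest open set whose preimage lies in \<open>W\<close>: that set
  contains no such saturation, since \<open>K\<close> would then lie in \<open>W\<close>.\<close>

lemma ex_generic_point_of_image:
  assumes Y: "well_filtered_space Y" and f: "continuous_map Z Y f"
    and \<K>: "\<K> \<subseteq> compact_saturated_sets Z" "filtered_family \<K>"
    and W: "maximal_avoiding Z \<K> W"
  shows "\<exists>y\<in>topspace Y. \<forall>V. openin Y V \<longrightarrow> (y \<in> V \<longleftrightarrow> \<not> {z \<in> topspace Z. f z \<in> V} \<subseteq> W)"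
proof -
  have compact: "compactin Z K" if "K \<in> \<K>" for K
    using \<K>(1) that by (auto simp: compact_saturated_sets_def)
  have image_subset: "f ` (K - W) \<subseteq> topspace Y" if "K \<in> \<K>" for K
    using compactin_subset_topspace[OF compact[OF that]] f
    by (auto dest: continuous_map_image_subset_topspace)
  define \<L> where "\<L> = (\<lambda>K. saturation_of Y (f ` (K - W))) ` \<K>"
  define G where "G = \<Union>{V. openin Y V \<and> {z \<in> topspace Z. f z \<in> V} \<subseteq> W}"
  have "saturation_of Y (f ` (K - W)) \<in> compact_saturated_sets Y" if K: "K \<in> \<K>" for K
  proof (rule saturation_of_in_compact_saturated_sets)
    have "compactin Z (K \<inter> (topspace Z - W))"
      using W by (intro compact_Int_closedin[OF compact[OF K]])
        (auto simp: maximal_avoiding_def)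
    moreover have "K - W = K \<inter> (topspace Z - W)"
      using compactin_subset_topspace[OF compact[OF K]] by blast
    ultimately show "compactin Y (f ` (K - W))"
      using image_compactin f by metis
    show "f ` (K - W) \<noteq> {}"
      using W K by (auto simp: maximal_avoiding_def)
  qed
  then have "\<L> \<subseteq> compact_saturated_sets Y"
    by (auto simp: \<L>_def)
  moreover have "filtered_family \<L>"
    unfolding filtered_family_def
  proof (intro conjI ballI)
    show "\<L> \<noteq> {}"
      using \<K>(2) by (auto simp: \<L>_def filtered_family_def)
    fix L1 L2 assume "L1 \<in> \<L>" "L2 \<in> \<L>"
    then obtain K1 K2 where K12: "K1 \<in> \<K>" "K2 \<in> \<K>"
      "L1 = saturation_of Y (f ` (K1 - W))" "L2 = saturation_of Y (f ` (K2 - W))"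
      by (auto simp: \<L>_def)
    then obtain K3 where K3: "K3 \<in> \<K>" "K3 \<subseteq> K1" "K3 \<subseteq> K2"
      using \<K>(2) unfolding filtered_family_def by meson
    have "saturation_of Y (f ` (K3 - W)) \<subseteq> L1 \<and> saturation_of Y (f ` (K3 - W)) \<subseteq> L2"
      unfolding K12 using K3 by (intro conjI saturation_of_mono) auto
    then show "\<exists>L3\<in>\<L>. L3 \<subseteq> L1 \<and> L3 \<subseteq> L2"
      using K3(1) by (auto simp: \<L>_def)
  qed
  moreover have "openin Y G"
    by (auto simp: G_def)
  moreover have "\<not> L \<subseteq> G" if L: "L \<in> \<L>" for L
  proof
    assume "L \<subseteq> G"
    obtain K where K: "K \<in> \<K>" "L = saturation_of Y (f ` (K - W))"
      using L unfolding \<L>_def by blast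
    have "f ` (K - W) \<subseteq> G"
      using saturation_of_superset[OF image_subset[OF K(1)]] \<open>L \<subseteq> G\<close> K(2) by blast
    then have "K \<subseteq> W"
      using compactin_subset_topspace[OF compact[OF K(1)]] by (fastforce simp: G_def)
    then show False
      using K(1) W by (auto simp: maximal_avoiding_def)
  qed
  ultimately have "\<not> \<Inter>\<L> \<subseteq> G"
    using Y unfolding well_filtered_space_def by blast
  then obtain y where y: "y \<in> \<Inter>\<L>" "y \<notin> G"
    by blast
  show ?thesis
  proof (intro bexI allI impI)
    show "y \<in> topspace Y"
      using y(1) \<K>(2) by (auto simp: \<L>_def saturation_of_def filtered_family_def)
    fix V assume V: "openin Y V"
    show "y \<in> V \<longleftrightarrow> \<not> {z \<in> topspace Z. f z \<in> V} \<subseteq> W"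
    proof
      show "y \<in> V \<Longrightarrow> \<not> {z \<in> topspace Z. f z \<in> V} \<subseteq> W"
        using y(2) V by (auto simp: G_def)
      assume "\<not> {z \<in> topspace Z. f z \<in> V} \<subseteq> W"
      then obtain K where K: "K \<in> \<K>" "K \<subseteq> W \<union> {z \<in> topspace Z. f z \<in> V}"
        using W openin_continuous_map_preimage[OF f V] unfolding maximal_avoiding_def by meson
      then have "saturation_of Y (f ` (K - W)) \<subseteq> V"
        by (intro saturation_of_minimal V) auto
      then show "y \<in> V"
        using y(1) K(1) by (auto simp: \<L>_def)
    qed
  qed
qed

section \<open>The function space\<close>

lemma topspace_pointwise_function_space:
  "topspace (pointwise_function_space X Y) =
    {f \<in> topspace X \<rightarrow>\<^sub>E topspace Y. continuous_map X Y f}"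
  by (auto simp: pointwise_function_space_def)

lemma continuous_map_evaluation:
  assumes "x \<in> topspace X"
  shows "continuous_map (pointwise_function_space X Y) Y (\<lambda>f. f x)"
  unfolding pointwise_function_space_def
  by (intro continuous_map_from_subtopology continuous_map_product_projection assms)

lemma pointwise_function_space_basic_nhd:
  assumes "openin (pointwise_function_space X Y) V" "f \<in> V"
  obtains I B where "finite I" "I \<subseteq> topspace X" "\<forall>x\<in>I. openin Y (B x)"
    "\<forall>x\<in>I. f x \<in> B x"
    "{h \<in> topspace (pointwise_function_space X Y). \<forall>x\<in>I. h x \<in> B x} \<subseteq> V"
proof -
  obtain T where T: "openin (product_topology (\<lambda>_. Y) (topspace X)) T"
    "V = T \<inter> {f. continuous_map X Y f}"
    using assms(1) by (auto simp: pointwise_function_space_def openin_subtopology)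
  then obtain B where B: "finite {x \<in> topspace X. B x \<noteq> topspace Y}"
    "\<forall>x\<in>topspace X. openin Y (B x)" "f \<in> Pi\<^sub>E (topspace X) B" "Pi\<^sub>E (topspace X) B \<subseteq> T"
    using assms(2) by (auto simp: openin_product_topology_alt)
  show ?thesis
  proof (rule that[of "{x \<in> topspace X. B x \<noteq> topspace Y}" B])
    show "{h \<in> topspace (pointwise_function_space X Y).
        \<forall>x\<in>{x \<in> topspace X. B x \<noteq> topspace Y}. h x \<in> B x} \<subseteq> V"
    proof
      fix h assume h: "h \<in> {h \<in> topspace (pointwise_function_space X Y).
        \<forall>x\<in>{x \<in> topspace X. B x \<noteq> topspace Y}. h x \<in> B x}"
      then have "h x \<in> B x" if "x \<in> topspace X" for x
        using that by (cases "B x = topspace Y") (auto simp: topspace_pointwise_function_space)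
      then have "h \<in> Pi\<^sub>E (topspace X) B"
        using h by (auto simp: topspace_pointwise_function_space PiE_iff)
      then show "h \<in> V"
        using B(4) T(2) h by (auto simp: topspace_pointwise_function_space)
    qed
  qed (use B in auto)
qed

theorem theorem6p23:
  fixes X :: "'a topology" and Y :: "'b topology"
  assumes "t0_space X" and "well_filtered_space Y"
  shows "well_filtered_space (pointwise_function_space X Y)"
proof (rule well_filtered_spaceI_generic_point)
  let ?F = "pointwise_function_space X Y"
  have "t0_space Y"
    using assms(2) by (simp add: well_filtered_space_def)
  then show "t0_space ?F"
    unfolding pointwise_function_space_def
    by (intro t0_space_subtopology) (simp add: t0_space_product_topology)
  fix \<K> W
  assume \<K>: "\<K> \<subseteq> compact_saturated_sets ?F" "filtered_family \<K>"
    and W: "maximal_avoiding ?F \<K> W"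
  have "\<forall>x\<in>topspace X. \<exists>y\<in>topspace Y.
      \<forall>V. openin Y V \<longrightarrow> (y \<in> V \<longleftrightarrow> \<not> {f \<in> topspace ?F. f x \<in> V} \<subseteq> W)"
    using ex_generic_point_of_image[OF assms(2) continuous_map_evaluation \<K> W] by blast
  then obtain g0 where g0: "\<And>x. x \<in> topspace X \<Longrightarrow> g0 x \<in> topspace Y"
    "\<And>x V. x \<in> topspace X \<Longrightarrow> openin Y V \<Longrightarrow>
      g0 x \<in> V \<longleftrightarrow> \<not> {f \<in> topspace ?F. f x \<in> V} \<subseteq> W"
    unfolding Bex_def bchoice_iff by blast
  define g where "g = restrict g0 (topspace X)"
  have g_space: "g x \<in> topspace Y" if "x \<in> topspace X" for x
    using g0(1) that by (simp add: g_def)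
  have g: "g x \<in> V \<longleftrightarrow> \<not> {f \<in> topspace ?F. f x \<in> V} \<subseteq> W"
    if "x \<in> topspace X" "openin Y V" for x V
    using g0(2) that by (simp add: g_def)
  have "continuous_map X Y g"
    unfolding continuous_map_def
  proof (intro conjI allI impI)
    fix V assume V: "openin Y V"
    \<comment> \<open>By genericity, \<open>g x \<in> V\<close> is witnessed by some \<open>f\<close> outside \<open>W\<close>, and conversely.\<close>
    have "{x \<in> topspace X. g x \<in> V} = (\<Union>f \<in> topspace ?F - W. {x \<in> topspace X. f x \<in> V})"
      using g[OF _ V] by blast
    moreover have "openin X {x \<in> topspace X. f x \<in> V}" if "f \<in> topspace ?F - W" for f
      using that V by (auto simp: topspace_pointwise_function_space
          intro: openin_continuous_map_preimage)
    ultimately show "openin X {x \<in> topspace X. g x \<in> V}"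
      by auto
  qed (use g_space in auto)
  then have g_mem: "g \<in> topspace ?F"
    using g_space by (auto simp: topspace_pointwise_function_space g_def)
  have "g \<in> V \<longleftrightarrow> \<not> V \<subseteq> W" if V: "openin ?F V" for V
  proof
    assume gV: "g \<in> V"
    obtain I B where B: "finite I" "I \<subseteq> topspace X" "\<forall>x\<in>I. openin Y (B x)"
      "\<forall>x\<in>I. g x \<in> B x" "{h \<in> topspace ?F. \<forall>x\<in>I. h x \<in> B x} \<subseteq> V"
      by (rule pointwise_function_space_basic_nhd[OF V gV])
    have "\<not> topspace ?F \<inter> (\<Inter>x\<in>I. {h \<in> topspace ?F. h x \<in> B x}) \<subseteq> W"
    proof (rule maximal_avoiding_prime_finite[OF \<K>(2) W _ B(1)])
      show "\<Union>\<K> \<subseteq> topspace ?F"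
        using \<K>(1) by (auto simp: compact_saturated_sets_def dest!: compactin_subset_topspace)
      show "openin ?F {h \<in> topspace ?F. h x \<in> B x}" if "x \<in> I" for x
        using that B(2,3)
        by (intro openin_continuous_map_preimage[OF continuous_map_evaluation]) auto
      show "\<not> {h \<in> topspace ?F. h x \<in> B x} \<subseteq> W" if "x \<in> I" for x
        using B(2-4) g that by blast
    qed
    then show "\<not> V \<subseteq> W"
      using B(5) by blast
  next
    \<comment> \<open>Every \<open>f\<close> outside \<open>W\<close> lies below \<open>g\<close> in the pointwise specialization order.\<close>
    assume "\<not> V \<subseteq> W"
    then obtain f where f: "f \<in> V" "f \<notin> W" "f \<in> topspace ?F"
      using openin_subset[OF V] by blast
    obtain I B where B: "finite I" "I \<subseteq> topspace X" "\<forall>x\<in>I. openin Y (B x)"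
      "\<forall>x\<in>I. f x \<in> B x" "{h \<in> topspace ?F. \<forall>x\<in>I. h x \<in> B x} \<subseteq> V"
      by (rule pointwise_function_space_basic_nhd[OF V f(1)])
    have "g x \<in> B x" if "x \<in> I" for x
      using f B(2-4) g that by blast
    then show "g \<in> V"
      using B(5) g_mem by blast
  qed
  then show "\<exists>p\<in>topspace ?F. \<forall>V. openin ?F V \<longrightarrow> (p \<in> V \<longleftrightarrow> \<not> V \<subseteq> W)"
    using g_mem by blast
qed

end
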